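(* Let $m$ be a positive integer, let $p_1,\ldots,p_m$ be distinct primes, let $I=\{1,\ldots,m\}$ and $n=\prod_{i\in I}p_i$. For each non-empty $S\subseteq I$ let $n_S=\prod_{i\in S}p_i$, let $\overline S=I\setminus S$ and $n_{\overline S}=\prod_{i\in\overline S}p_i$ (an empty product being $1$), and let $U_S=\{n_{\overline S}\,x : x\in U_{n_S}\}\subseteq\mathbb{Z}_n$; let $U_\emptyset=\{0\}$. Then for every non-empty subset $S\subseteq I$, $U_S$ is a subgroup of the multiplicative semigroup $\mathbb{Z}_n$, and $U_S$ is isomorphic to the group $U_{n_S}$. Moreover $\mathbb{Z}_n$ is the disjoint union $\mathbb{Z}_n=\dot\bigcup_{S\subseteq I}U_S$, and this exhibits the multiplicative semigroup $\mathbb{Z}_n$ as a strong semilattice of the groups $U_S$ over the semilattice $Y=\mathcal{P}(I)$, the Boolean algebra of all subsets of $I$ with meet given by intersection.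
   Context: $\mathbb{Z}_n=\{0,1,\ldots,n-1\}$ is the ring of integers modulo $n$, and $U_k$ denotes the group of units modulo $k$, whose elements are represented by least non-negative residues. A subgroup of a semigroup is a subset that is a group under the semigroup operation (its identity need not be an identity of the whole semigroup). A semigroup $T$ is a semilattice of groups $T_\alpha$ ($\alpha\in Y$), where $Y$ is a (meet-)semilattice, if $T=\dot\bigcup_{\alpha\in Y}T_\alpha$ is a disjoint union of subgroups with $T_\alpha T_\beta\subseteq T_{\alpha\wedge\beta}$. It is a strong semilattice of groups if there are group homomorphisms (structure maps) $\phi^\alpha_\beta:T_\alpha\to T_\beta$ for $\alpha\ge\beta$ such that $\phi^\alpha_\alpha$ is the identity map, $\phi^\beta_\gamma\circ\phi^\alpha_\beta=\phi^\alpha_\gamma$ for $\alpha\ge\beta\ge\gamma$, and $xy=\phi^\alpha_{\alpha\wedge\beta}(x)\,\phi^\beta_{\alpha\wedge\beta}(y)$ for all $x\in T_\alpha$, $y\in T_\beta$. *)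

theory Defs
  imports "HOL-Number_Theory.Residues" "HOL-Library.Disjoint_Sets"
begin

text \<open>
  A semigroup is given by the carrier and multiplication of a \<^type>\<open>monoid_scheme\<close> record;
  the unit field of the record is ignored.
\<close>
definition mult_semigroup :: "('a, 'b) monoid_scheme \<Rightarrow> bool" where
  "mult_semigroup T \<longleftrightarrow>
     (\<forall>x\<in>carrier T. \<forall>y\<in>carrier T. x \<otimes>\<^bsub>T\<^esub> y \<in> carrier T) \<and>
     (\<forall>x\<in>carrier T. \<forall>y\<in>carrier T. \<forall>z\<in>carrier T.
        (x \<otimes>\<^bsub>T\<^esub> y) \<otimes>\<^bsub>T\<^esub> z = x \<otimes>\<^bsub>T\<^esub> (y \<otimes>\<^bsub>T\<^esub> z))"

text \<open>
  The unit of the restricted structure is the two-sided identity of \<open>H\<close>, which need not be the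
  unit of \<open>T\<close>. It is unique if it exists; if it does not exist, the result is not a group.
\<close>
definition restrict_mult :: "('a, 'b) monoid_scheme \<Rightarrow> 'a set \<Rightarrow> 'a monoid" where
  "restrict_mult T H =
     \<lparr>carrier = H, monoid.mult = (\<otimes>\<^bsub>T\<^esub>),
      one = (THE e. e \<in> H \<and> (\<forall>x\<in>H. e \<otimes>\<^bsub>T\<^esub> x = x \<and> x \<otimes>\<^bsub>T\<^esub> e = x))\<rparr>"

definition semigroup_subgroup :: "'a set \<Rightarrow> ('a, 'b) monoid_scheme \<Rightarrow> bool" where
  "semigroup_subgroup H T \<longleftrightarrow> H \<subseteq> carrier T \<and> group (restrict_mult T H)"

text \<open>
  The index semilattice is a subset \<open>Y\<close> of a type of class \<^class>\<open>semilattice_inf\<close> that is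
  closed under \<^const>\<open>inf\<close>.
\<close>
definition semilattice_of_groups ::
  "('a, 'b) monoid_scheme \<Rightarrow> 'i::semilattice_inf set \<Rightarrow> ('i \<Rightarrow> 'a set) \<Rightarrow> bool" where
  "semilattice_of_groups T Y G \<longleftrightarrow>
     mult_semigroup T \<and>
     (\<forall>\<alpha>\<in>Y. \<forall>\<beta>\<in>Y. inf \<alpha> \<beta> \<in> Y) \<and>
     (\<forall>\<alpha>\<in>Y. semigroup_subgroup (G \<alpha>) T) \<and>
     carrier T = (\<Union>\<alpha>\<in>Y. G \<alpha>) \<and>
     disjoint_family_on G Y \<and>
     (\<forall>\<alpha>\<in>Y. \<forall>\<beta>\<in>Y. \<forall>x\<in>G \<alpha>. \<forall>y\<in>G \<beta>. x \<otimes>\<^bsub>T\<^esub> y \<in> G (inf \<alpha> \<beta>))"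

definition strong_semilattice_of_groups ::
  "('a, 'b) monoid_scheme \<Rightarrow> 'i::semilattice_inf set \<Rightarrow> ('i \<Rightarrow> 'a set) \<Rightarrow> bool" where
  "strong_semilattice_of_groups T Y G \<longleftrightarrow>
     semilattice_of_groups T Y G \<and>
     (\<exists>\<phi> :: 'i \<Rightarrow> 'i \<Rightarrow> 'a \<Rightarrow> 'a.
        (\<forall>\<alpha>\<in>Y. \<forall>\<beta>\<in>Y. \<beta> \<le> \<alpha> \<longrightarrow>
           \<phi> \<alpha> \<beta> \<in> hom (restrict_mult T (G \<alpha>)) (restrict_mult T (G \<beta>))) \<and>
        (\<forall>\<alpha>\<in>Y. \<forall>x\<in>G \<alpha>. \<phi> \<alpha> \<alpha> x = x) \<and>
        (\<forall>\<alpha>\<in>Y. \<forall>\<beta>\<in>Y. \<forall>\<gamma>\<in>Y. \<beta> \<le> \<alpha> \<longrightarrow> \<gamma> \<le> \<beta> \<longrightarrow>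
           (\<forall>x\<in>G \<alpha>. \<phi> \<beta> \<gamma> (\<phi> \<alpha> \<beta> x) = \<phi> \<alpha> \<gamma> x)) \<and>
        (\<forall>\<alpha>\<in>Y. \<forall>\<beta>\<in>Y. \<forall>x\<in>G \<alpha>. \<forall>y\<in>G \<beta>.
           x \<otimes>\<^bsub>T\<^esub> y = \<phi> \<alpha> (inf \<alpha> \<beta>) x \<otimes>\<^bsub>T\<^esub> \<phi> \<beta> (inf \<alpha> \<beta>) y))"

text \<open>
  The ring of integers modulo \<open>k > 1\<close> is \<^term>\<open>residue_ring k\<close>, with carrier \<open>{0..k - 1}\<close>, so
  \<^term>\<open>Units (residue_ring k)\<close> consists of least non-negative residues. The product below needs
  no reduction: for \<open>0 \<le> x < (\<Prod>i\<in>S. p i)\<close> it is less than \<open>\<Prod>i\<in>I. p i\<close>.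
\<close>
definition unit_component :: "nat set \<Rightarrow> (nat \<Rightarrow> int) \<Rightarrow> nat set \<Rightarrow> int set" where
  "unit_component I p S =
     (if S = {} then {0}
      else {(\<Prod>i\<in>I - S. p i) * x | x. x \<in> Units (residue_ring (\<Prod>i\<in>S. p i))})"

end

theory Submission
  imports Defs "HOL-Number_Theory.Modular_Inverse"
begin

text \<open>
  Call the set of those \<open>i \<in> I\<close> for which \<open>p i\<close> does not divide \<open>z\<close> the support of \<open>z\<close>. Since the
  \<open>p i\<close> are prime, the support of a product is the intersection of the supports, and reduction
  modulo \<open>n\<close> does not change the support because every \<open>p i\<close> divides \<open>n\<close>. So the support is a
  semigroup morphism from \<open>\<int>\<^sub>n\<close> to the subsets of \<open>I\<close> under intersection, and the components
  \<open>U\<^sub>S\<close> are exactly its fibres (\<open>unit_component_eq_support_fibre\<close>). This gives the disjoint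
  union and the inclusion of \<open>U\<^sub>S U\<^sub>T\<close> in the component of \<open>S \<inter> T\<close> at once.

  The remaining claims are calculations in the product of the fields \<open>\<int>/p\<^sub>i\<close>: by the Chinese
  remainder theorem a congruence modulo a product of some of the \<open>p i\<close> can be checked modulo each
  of them. In this product, let \<open>e\<^sub>S\<close> be the idempotent with coordinate \<open>1\<close> at the \<open>i \<in> S\<close> and \<open>0\<close>
  elsewhere. Multiplication by \<open>e\<^sub>S\<close> keeps the coordinates in \<open>S\<close> and clears the others
  (\<open>cong_proj\<close>). Therefore \<open>e\<^sub>S\<close> is the identity of \<open>U\<^sub>S\<close>; an inverse modulo the product of the
  primes in \<open>S\<close>, multiplied by \<open>e\<^sub>S\<close>, is an inverse in \<open>U\<^sub>S\<close>; reduction modulo that product is an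
  isomorphism from \<open>U\<^sub>S\<close> to the units, undone by multiplication by \<open>e\<^sub>S\<close>; and the structure map
  from \<open>U\<^sub>S\<close> to \<open>U\<^sub>T\<close> is multiplication by \<open>e\<^sub>T\<close>.
\<close>

section \<open>Subgroups of a semigroup\<close>

lemma restrict_mult_simps [simp]:
  "carrier (restrict_mult T H) = H"
  "x \<otimes>\<^bsub>restrict_mult T H\<^esub> y = x \<otimes>\<^bsub>T\<^esub> y"
  by (simp_all add: restrict_mult_def)

lemma one_restrict_mult:
  assumes "e \<in> H" "\<And>x. x \<in> H \<Longrightarrow> e \<otimes>\<^bsub>T\<^esub> x = x" "\<And>x. x \<in> H \<Longrightarrow> x \<otimes>\<^bsub>T\<^esub> e = x"
  shows "\<one>\<^bsub>restrict_mult T H\<^esub> = e"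
proof -
  have "(THE e. e \<in> H \<and> (\<forall>x\<in>H. e \<otimes>\<^bsub>T\<^esub> x = x \<and> x \<otimes>\<^bsub>T\<^esub> e = x)) = e"
    by (rule the_equality) (use assms in \<open>blast, metis\<close>)
  then show ?thesis
    by (simp add: restrict_mult_def)
qed

lemma semigroup_subgroupI:
  assumes T: "mult_semigroup T" and sub: "H \<subseteq> carrier T"
    and closed: "\<And>x y. x \<in> H \<Longrightarrow> y \<in> H \<Longrightarrow> x \<otimes>\<^bsub>T\<^esub> y \<in> H"
    and e: "e \<in> H" "\<And>x. x \<in> H \<Longrightarrow> e \<otimes>\<^bsub>T\<^esub> x = x" "\<And>x. x \<in> H \<Longrightarrow> x \<otimes>\<^bsub>T\<^esub> e = x"
    and inv: "\<And>x. x \<in> H \<Longrightarrow> \<exists>y\<in>H. y \<otimes>\<^bsub>T\<^esub> x = e"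
  shows "semigroup_subgroup H T"
proof -
  have one: "\<one>\<^bsub>restrict_mult T H\<^esub> = e"
    by (rule one_restrict_mult) (use e in auto)
  have "group (restrict_mult T H)"
    by (rule groupI) (use T sub closed e inv in \<open>auto simp: one mult_semigroup_def subset_iff\<close>)
  with sub show ?thesis
    by (simp add: semigroup_subgroup_def)
qed

section \<open>Residues modulo a product of distinct primes\<close>

lemma residue_ring_simps [simp]:
  "carrier (residue_ring k) = {0..<k}"
  "x \<otimes>\<^bsub>residue_ring k\<^esub> y = (x * y) mod k"
  by (auto simp: residue_ring_def)

lemma mult_semigroup_residue_ring:
  assumes "k > 0"
  shows "mult_semigroup (residue_ring k)"
  using assms by (auto simp: mult_semigroup_def mod_simps mult.assoc)

locale distinct_primes =
  fixes I :: "nat set" and p :: "nat \<Rightarrow> int"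
  assumes finite_I: "finite I"
    and prime_p: "i \<in> I \<Longrightarrow> prime (p i)"
    and inj_p: "inj_on p I"
begin

abbreviation N :: "nat set \<Rightarrow> int" where
  "N S \<equiv> \<Prod>i\<in>S. p i"

abbreviation n :: int where
  "n \<equiv> N I"

lemma N_pos: "S \<subseteq> I \<Longrightarrow> N S > 0"
  by (rule prod_pos) (use prime_p prime_gt_0_int in blast)

lemma N_gt_1:
  assumes "S \<subseteq> I" "S \<noteq> {}"
  shows "N S > 1"
proof -
  obtain i where i: "i \<in> S"
    using assms by blast
  then have "p i dvd N S"
    using assms finite_I by (meson dvd_prodI finite_subset)
  then have "p i \<le> N S"
    using N_pos[OF assms(1)] by (rule zdvd_imp_le)
  moreover have "p i > 1"
    using prime_p i assms(1) prime_gt_1_int by blast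
  ultimately show ?thesis
    by linarith
qed

lemma prime_dvd_N_iff:
  assumes "S \<subseteq> I" "i \<in> I"
  shows "p i dvd N S \<longleftrightarrow> i \<in> S"
proof -
  have fin: "finite S"
    using assms(1) finite_I by (rule finite_subset)
  have "p i dvd p j \<longleftrightarrow> i = j" if "j \<in> S" for j
    using that assms prime_p inj_p
    by (metis dvd_refl inj_onD primes_dvd_imp_eq subsetD)
  then show ?thesis
    using prime_dvd_prod_iff[OF fin prime_p[OF assms(2)], of p] by auto
qed

lemma coprime_N_iff:
  assumes "S \<subseteq> I"
  shows "coprime x (N S) \<longleftrightarrow> (\<forall>i\<in>S. \<not> p i dvd x)"
proof
  assume "coprime x (N S)"
  then show "\<forall>i\<in>S. \<not> p i dvd x"
    using assms prime_p prime_dvd_N_iff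
    by (metis coprime_common_divisor not_prime_unit subsetD)
next
  assume "\<forall>i\<in>S. \<not> p i dvd x"
  then show "coprime x (N S)"
    using assms prime_p
    by (intro prod_coprime_right) (metis coprime_commute prime_imp_coprime subsetD)
qed

text \<open>
  This is the uniqueness part of the Chinese remainder theorem. Through it, identities between
  residues are checked one prime at a time.
\<close>
lemma cong_N_iff:
  assumes "S \<subseteq> I"
  shows "[x = y] (mod N S) \<longleftrightarrow> (\<forall>i\<in>S. [x = y] (mod p i))"
proof
  assume "[x = y] (mod N S)"
  then show "\<forall>i\<in>S. [x = y] (mod p i)"
    using assms prime_dvd_N_iff by (meson cong_dvd_modulus subsetD)
next
  assume "\<forall>i\<in>S. [x = y] (mod p i)"
  moreover have "coprime (p i) (p j)" if "i \<in> S" "j \<in> S" "i \<noteq> j" for i j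
    using that assms prime_p inj_p by (metis inj_onD primes_coprime subsetD)
  ultimately show "[x = y] (mod N S)"
    by (intro cong_cong_prod_coprime) auto
qed

lemma N_dvd_iff:
  assumes "S \<subseteq> I"
  shows "N S dvd x \<longleftrightarrow> (\<forall>i\<in>S. p i dvd x)"
  using cong_N_iff[OF assms, of x 0] by (simp add: cong_0_iff)

lemma residue_eqI:
  assumes "x \<in> {0..<n}" "y \<in> {0..<n}" "\<And>i. i \<in> I \<Longrightarrow> [x = y] (mod p i)"
  shows "x = y"
  using assms cong_N_iff[of I x y] cong_less_imp_eq_int[of x n y] by auto

lemma cong_mod_n: "i \<in> I \<Longrightarrow> [x mod n = x] (mod p i)"
  using cong_N_iff[of I "x mod n" x] by simp

lemma mod_n_in_range: "x mod n \<in> {0..<n}"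
  using N_pos[of I] by simp

section \<open>The components as fibres of the support\<close>

definition support :: "int \<Rightarrow> nat set" where
  "support x = {i \<in> I. \<not> p i dvd x}"

lemma support_mult: "support (x * y) = support x \<inter> support y"
  using prime_p by (auto simp: support_def prime_dvd_mult_iff)

lemma support_mod_n: "support (x mod n) = support x"
  using cong_mod_n cong_dvd_iff by (fastforce simp: support_def)

lemma support_cofactor_mult:
  assumes "S \<subseteq> I"
  shows "support (N (I - S) * x) = S \<longleftrightarrow> coprime x (N S)"
proof -
  have "support (N (I - S)) = S"
    using assms prime_dvd_N_iff[of "I - S"] by (auto simp: support_def)
  then have "support (N (I - S) * x) = S \<longleftrightarrow> S \<subseteq> support x"
    by (auto simp: support_mult)
  also have "\<dots> \<longleftrightarrow> coprime x (N S)"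
    using assms by (auto simp: support_def coprime_N_iff)
  finally show ?thesis .
qed

lemma n_eq_cofactor_mult: "S \<subseteq> I \<Longrightarrow> n = N (I - S) * N S"
  using finite_I by (simp add: prod.subset_diff)

lemma Units_residue_ring_N:
  assumes "S \<subseteq> I" "S \<noteq> {}"
  shows "Units (residue_ring (N S)) = {x. 0 < x \<and> x < N S \<and> coprime x (N S)}"
  using residues.res_units_eq[OF residues.intro[OF N_gt_1[OF assms]]] .

text \<open>
  An element whose support is \<open>S\<close> is divisible by the complementary primes, hence of the form
  \<open>N (I - S) * x\<close>; its support is all of \<open>S\<close> if and only if \<open>x\<close> is a unit modulo \<open>N S\<close>. The case
  \<open>S = {}\<close>, which is separate in the definition of the components, falls under the same rule: only
  \<open>0\<close> is divisible by all the primes.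
\<close>
lemma unit_component_eq_support_fibre:
  assumes "S \<subseteq> I"
  shows "unit_component I p S = {x \<in> {0..<n}. support x = S}"
proof (cases "S = {}")
  case True
  have "x = 0" if "x \<in> {0..<n}" "support x = {}" for x
    using that N_pos[of I] by (intro residue_eqI) (auto simp: support_def cong_0_iff)
  then show ?thesis
    using True N_pos[of I] by (auto simp: unit_component_def support_def)
next
  case False
  have pos: "N (I - S) > 0"
    by (rule N_pos) auto
  have "z \<in> unit_component I p S \<longleftrightarrow> z \<in> {0..<n} \<and> support z = S" for z
  proof
    assume "z \<in> unit_component I p S"
    then obtain x where x: "z = N (I - S) * x" "0 < x" "x < N S" "coprime x (N S)"
      using False Units_residue_ring_N[OF assms False] by (auto simp: unit_component_def)
    then show "z \<in> {0..<n} \<and> support z = S"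
      using pos assms n_eq_cofactor_mult support_cofactor_mult by simp
  next
    assume z: "z \<in> {0..<n} \<and> support z = S"
    then have "N (I - S) dvd z"
      by (subst N_dvd_iff) (auto simp: support_def)
    then obtain x where x: "z = N (I - S) * x" ..
    have cop: "coprime x (N S)"
      using z x assms support_cofactor_mult by simp
    have "0 \<le> x" "x < N S"
      using z pos n_eq_cofactor_mult[OF assms] by (auto simp: x zero_le_mult_iff)
    moreover have "x \<noteq> 0"
      using cop N_gt_1[OF assms False] by auto
    ultimately show "z \<in> unit_component I p S"
      using x cop False Units_residue_ring_N[OF assms False] by (auto simp: unit_component_def)
  qed
  then show ?thesis
    by blast
qed

lemma in_unit_component_iff:
  assumes "S \<subseteq> I"
  shows "x \<in> unit_component I p S \<longleftrightarrow> x \<in> {0..<n} \<and> support x = S"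
  using unit_component_eq_support_fibre[OF assms] by blast

lemma unit_component_mult:
  assumes "S \<subseteq> I" "T \<subseteq> I" "x \<in> unit_component I p S" "y \<in> unit_component I p T"
  shows "(x * y) mod n \<in> unit_component I p (S \<inter> T)"
proof -
  have "S \<inter> T \<subseteq> I"
    using assms(1) by blast
  then show ?thesis
    using assms mod_n_in_range
    by (auto simp: in_unit_component_iff support_mod_n support_mult)
qed

lemma residues_eq_Union_unit_component: "{0..<n} = (\<Union>S\<in>Pow I. unit_component I p S)"
proof -
  have "support x \<subseteq> I" for x
    by (auto simp: support_def)
  then show ?thesis
    by (auto simp: in_unit_component_iff)
qed

lemma disjoint_unit_component: "disjoint_family_on (unit_component I p) (Pow I)"
  by (auto simp: disjoint_family_on_def in_unit_component_iff)

section \<open>Idempotents and projections\<close>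

text \<open>
  The factor \<open>N (I - S)\<close> clears the coordinates outside \<open>S\<close>, and its inverse modulo \<open>N S\<close>
  brings those in \<open>S\<close> to \<open>1\<close>. For \<open>S = {}\<close> the value is \<open>0\<close>, since the first factor is then \<open>n\<close>.
\<close>
definition idem :: "nat set \<Rightarrow> int" where
  "idem S = (N (I - S) * modular_inverse (N S) (N (I - S))) mod n"

lemma cong_idem:
  assumes "S \<subseteq> I" "i \<in> I"
  shows "[idem S = (if i \<in> S then 1 else 0)] (mod p i)"
proof -
  let ?a = "N (I - S) * modular_inverse (N S) (N (I - S))"
  have "[?a = (if i \<in> S then 1 else 0)] (mod p i)"
  proof (cases "i \<in> S")
    case True
    have "coprime (N (I - S)) (N S)"
      using support_cofactor_mult[OF assms(1), of 1] assms(1)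
      by (subst coprime_N_iff) (auto simp: support_def)
    then have "[?a = 1] (mod N S)"
      by (rule cong_modular_inverse1)
    then show ?thesis
      using True assms(1) cong_N_iff by auto
  next
    case False
    then show ?thesis
      using prime_dvd_N_iff[of "I - S" i] assms(2) by (simp add: cong_0_iff)
  qed
  moreover have "[idem S = ?a] (mod p i)"
    unfolding idem_def using assms(2) by (rule cong_mod_n)
  ultimately show ?thesis
    by (rule cong_trans[rotated])
qed

definition proj :: "nat set \<Rightarrow> int \<Rightarrow> int" where
  "proj S x = (idem S * x) mod n"

lemma proj_in_range: "proj S x \<in> {0..<n}"
  unfolding proj_def by (rule mod_n_in_range)

lemma cong_proj:
  assumes "S \<subseteq> I" "i \<in> I"
  shows "[proj S x = (if i \<in> S then x else 0)] (mod p i)"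
proof -
  have "[proj S x = idem S * x] (mod p i)"
    unfolding proj_def using assms(2) by (rule cong_mod_n)
  also have "[idem S * x = (if i \<in> S then 1 else 0) * x] (mod p i)"
    using assms by (intro cong_mult cong_idem) auto
  finally show ?thesis
    by (simp split: if_splits)
qed

lemma support_proj:
  assumes "S \<subseteq> I"
  shows "support (proj S x) = S \<inter> support x"
proof -
  have "p i dvd proj S x \<longleftrightarrow> i \<notin> S \<or> p i dvd x" if "i \<in> I" for i
    using cong_dvd_iff[OF cong_proj[OF assms that]] by auto
  then show ?thesis
    using assms by (auto simp: support_def)
qed

lemma proj_in_unit_component:
  assumes "T \<subseteq> S" "S \<subseteq> I" "x \<in> unit_component I p S"
  shows "proj T x \<in> unit_component I p T"
proof -
  have "T \<subseteq> I"
    using assms by blast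
  then show ?thesis
    using assms proj_in_range by (auto simp: in_unit_component_iff support_proj)
qed

text \<open>
  The idempotent is the projection of \<open>1\<close>, and \<open>1\<close> has support \<open>I\<close>.
\<close>
lemma idem_in_unit_component:
  assumes "S \<subseteq> I"
  shows "idem S \<in> unit_component I p S"
proof -
  have "proj S 1 = idem S"
    by (simp add: proj_def idem_def)
  moreover have "\<not> p i dvd 1" if "i \<in> I" for i
    using prime_p[OF that] not_prime_unit by blast
  then have "support 1 = I"
    unfolding support_def by blast
  ultimately show ?thesis
    using assms proj_in_range[of S 1] support_proj[OF assms, of 1]
    by (auto simp: in_unit_component_iff)
qed

lemma proj_unit_component:
  assumes "S \<subseteq> I" "x \<in> unit_component I p S"
  shows "proj S x = x"
proof (rule residue_eqI)
  fix i assume i: "i \<in> I"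
  have "[(if i \<in> S then x else 0) = x] (mod p i)"
    using assms i by (auto simp: in_unit_component_iff support_def cong_def)
  with cong_proj[OF assms(1) i] show "[proj S x = x] (mod p i)"
    by (rule cong_trans)
qed (use assms proj_in_range in \<open>auto simp: in_unit_component_iff\<close>)

lemma proj_proj:
  assumes "T \<subseteq> S" "S \<subseteq> I"
  shows "proj T (proj S x) = proj T x"
proof (rule residue_eqI)
  fix i assume i: "i \<in> I"
  have T: "T \<subseteq> I"
    using assms by blast
  have "[proj T (proj S x) = (if i \<in> T then proj S x else 0)] (mod p i)"
    using T i by (rule cong_proj)
  also have "[(if i \<in> T then proj S x else 0) = (if i \<in> T then x else 0)] (mod p i)"
    using cong_proj[OF assms(2) i, of x] assms(1) by (auto split: if_splits)
  also have "[(if i \<in> T then x else 0) = proj T x] (mod p i)"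
    using cong_proj[OF T i, of x] by (rule cong_sym)
  finally show "[proj T (proj S x) = proj T x] (mod p i)" .
qed (rule proj_in_range)+

lemma proj_mult:
  assumes "S \<subseteq> I"
  shows "proj S ((x * y) mod n) = (proj S x * proj S y) mod n"
proof (rule residue_eqI)
  fix i assume i: "i \<in> I"
  have "[proj S ((x * y) mod n) = (if i \<in> S then (x * y) mod n else 0)] (mod p i)"
    using assms i by (rule cong_proj)
  also have "[(if i \<in> S then (x * y) mod n else 0) =
      (if i \<in> S then x else 0) * (if i \<in> S then y else 0)] (mod p i)"
    using cong_mod_n[OF i] by simp
  also have "[(if i \<in> S then x else 0) * (if i \<in> S then y else 0) = proj S x * proj S y] (mod p i)"
    by (rule cong_mult; rule cong_sym, rule cong_proj[OF assms i])
  also have "[proj S x * proj S y = (proj S x * proj S y) mod n] (mod p i)"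
    using cong_mod_n[OF i] by (rule cong_sym)
  finally show "[proj S ((x * y) mod n) = (proj S x * proj S y) mod n] (mod p i)" .
qed (rule proj_in_range mod_n_in_range)+

section \<open>The components are groups of units\<close>

text \<open>
  An inverse \<open>y\<close> of \<open>x\<close> modulo \<open>N S\<close> exists since \<open>x\<close> is prime to \<open>N S\<close>; clearing the coordinates
  of \<open>y\<close> outside \<open>S\<close> moves it into the component.
\<close>
lemma unit_component_inverse:
  assumes "S \<subseteq> I" "x \<in> unit_component I p S"
  shows "\<exists>y\<in>unit_component I p S. (y * x) mod n = idem S"
proof -
  have "coprime x (N S)"
    using assms by (auto simp: in_unit_component_iff coprime_N_iff support_def)
  then obtain y where "[x * y = 1] (mod N S)"
    using cong_solve_coprime_int by blast
  then have y: "[x * y = 1] (mod p i)" if "i \<in> S" for i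
    using assms(1) cong_N_iff that by blast
  have "S \<subseteq> support y"
  proof
    fix i assume i: "i \<in> S"
    then have "\<not> p i dvd x * y"
      using cong_dvd_iff[OF y[OF i]] assms(1) prime_p not_prime_unit by blast
    then show "i \<in> support y"
      using i assms(1) by (auto simp: support_def)
  qed
  then have "proj S y \<in> unit_component I p S"
    using assms(1) proj_in_range by (auto simp: in_unit_component_iff support_proj)
  moreover have "(proj S y * x) mod n = idem S"
  proof (rule residue_eqI)
    fix i assume i: "i \<in> I"
    have "[(proj S y * x) mod n = proj S y * x] (mod p i)"
      using i by (rule cong_mod_n)
    also have "[proj S y * x = (if i \<in> S then y else 0) * x] (mod p i)"
      by (intro cong_mult cong_proj assms(1) i cong_refl)
    also have "[(if i \<in> S then y else 0) * x = (if i \<in> S then 1 else 0)] (mod p i)"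
      using y[of i] by (simp add: mult.commute)
    also have "[(if i \<in> S then 1 else 0) = idem S] (mod p i)"
      using cong_idem[OF assms(1) i] by (rule cong_sym)
    finally show "[(proj S y * x) mod n = idem S] (mod p i)" .
  qed (use mod_n_in_range in \<open>auto simp: idem_def\<close>)
  ultimately show ?thesis
    by blast
qed

lemma unit_component_subgroup:
  assumes "S \<subseteq> I"
  shows "semigroup_subgroup (unit_component I p S) (residue_ring n)"
proof (rule semigroup_subgroupI[where e = "idem S"])
  show "mult_semigroup (residue_ring n)"
    by (rule mult_semigroup_residue_ring) (simp add: N_pos)
  show "unit_component I p S \<subseteq> carrier (residue_ring n)"
    using assms by (auto simp: in_unit_component_iff)
  show "idem S \<in> unit_component I p S"
    using assms by (rule idem_in_unit_component)
  fix x assume x: "x \<in> unit_component I p S"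
  show "idem S \<otimes>\<^bsub>residue_ring n\<^esub> x = x"
    using proj_unit_component[OF assms x] by (simp add: proj_def)
  then show "x \<otimes>\<^bsub>residue_ring n\<^esub> idem S = x"
    by (simp add: mult.commute)
  show "\<exists>y\<in>unit_component I p S. y \<otimes>\<^bsub>residue_ring n\<^esub> x = idem S"
    using unit_component_inverse[OF assms x] by simp
  fix y assume "y \<in> unit_component I p S"
  then show "x \<otimes>\<^bsub>residue_ring n\<^esub> y \<in> unit_component I p S"
    using unit_component_mult[OF assms assms x] by simp
qed

text \<open>
  The isomorphism is reduction modulo \<open>N S\<close>, with inverse \<open>proj S\<close>. The map \<open>x \<mapsto> N (I - S) * x\<close>
  by which the components are defined is a bijection too, but in general not a homomorphism.
\<close>
lemma unit_component_iso_units: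
  assumes "S \<subseteq> I" "S \<noteq> {}"
  shows "restrict_mult (residue_ring n) (unit_component I p S)
           \<cong> units_of (residue_ring (N S))"
proof (rule is_isoI, rule isoI)
  let ?f = "\<lambda>x. x mod N S"
  let ?U = "unit_component I p S" and ?V = "Units (residue_ring (N S))"
  have "\<not> coprime 0 (N S)"
    using N_gt_1[OF assms] by auto
  then have V: "u \<in> ?V \<longleftrightarrow> u \<in> {0..<N S} \<and> coprime u (N S)" for u
    unfolding Units_residue_ring_N[OF assms] by (cases "u = 0") (simp_all, linarith)
  have f_closed: "?f x \<in> ?V" if "x \<in> ?U" for x
  proof -
    have "coprime x (N S)"
      using that assms(1) by (auto simp: in_unit_component_iff coprime_N_iff support_def)
    then show ?thesis
      using N_pos[OF assms(1)] by (simp add: V)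
  qed
  have dvd: "N S dvd n"
    using n_eq_cofactor_mult[OF assms(1)] by simp
  show "?f \<in> hom (restrict_mult (residue_ring n) ?U) (units_of (residue_ring (N S)))"
    using f_closed dvd
    by (intro homI) (auto simp: units_of_carrier units_of_mult mod_mod_cancel mod_simps)
  have "proj S (?f x) = x" if x: "x \<in> ?U" for x
  proof -
    have "proj S (?f x) = proj S x"
    proof (rule residue_eqI)
      fix i assume i: "i \<in> I"
      have "[(if i \<in> S then ?f x else 0) = (if i \<in> S then x else 0)] (mod p i)"
        using cong_N_iff[OF assms(1), of "?f x" x] by simp
      then show "[proj S (?f x) = proj S x] (mod p i)"
        using cong_proj[OF assms(1) i] by (meson cong_sym cong_trans)
    qed (rule proj_in_range)+
    also have "\<dots> = x"
      using assms(1) x by (rule proj_unit_component)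
    finally show ?thesis .
  qed
  moreover have "?f (proj S u) = u" "proj S u \<in> ?U" if u: "u \<in> ?V" for u
  proof -
    have "[proj S u = u] (mod N S)"
      using cong_proj[OF assms(1), of _ u] assms(1) by (subst cong_N_iff) force+
    then show "?f (proj S u) = u"
      using u by (simp add: V cong_def)
    have "S \<subseteq> support u"
      using u assms(1) by (auto simp: V coprime_N_iff support_def)
    then show "proj S u \<in> ?U"
      using assms(1) proj_in_range by (auto simp: in_unit_component_iff support_proj)
  qed
  ultimately have "bij_betw ?f ?U ?V"
    using f_closed by (intro bij_betw_byWitness[where f' = "proj S"]) auto
  then show "bij_betw ?f (carrier (restrict_mult (residue_ring n) ?U))
      (carrier (units_of (residue_ring (N S))))"
    by (simp add: units_of_carrier)
qed

section \<open>The strong semilattice\<close>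

lemma semilattice_unit_component:
  "semilattice_of_groups (residue_ring n) (Pow I) (unit_component I p)"
  unfolding semilattice_of_groups_def
  using mult_semigroup_residue_ring[OF N_pos[of I]] unit_component_subgroup
    disjoint_unit_component residues_eq_Union_unit_component unit_component_mult
  by auto

lemma proj_hom:
  assumes "T \<subseteq> S" "S \<subseteq> I"
  shows "proj T \<in> hom (restrict_mult (residue_ring n) (unit_component I p S))
                       (restrict_mult (residue_ring n) (unit_component I p T))"
  using assms proj_in_unit_component[OF assms] proj_mult[of T]
  by (intro homI) auto

text \<open>
  Applying \<open>proj (S \<inter> T)\<close> to both factors applies it to the product, which it fixes because the
  product lies in the component of \<open>S \<inter> T\<close>.
\<close>
lemma mult_eq_mult_proj:
  assumes "S \<subseteq> I" "T \<subseteq> I" "x \<in> unit_component I p S" "y \<in> unit_component I p T"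
  shows "(x * y) mod n = (proj (S \<inter> T) x * proj (S \<inter> T) y) mod n"
proof -
  have sub: "S \<inter> T \<subseteq> I"
    using assms(1) by blast
  have "(x * y) mod n = proj (S \<inter> T) ((x * y) mod n)"
    using proj_unit_component[OF sub unit_component_mult[OF assms]] by simp
  also have "\<dots> = (proj (S \<inter> T) x * proj (S \<inter> T) y) mod n"
    using sub by (rule proj_mult)
  finally show ?thesis .
qed

lemma strong_semilattice_unit_component:
  "strong_semilattice_of_groups (residue_ring n) (Pow I) (unit_component I p)"
  unfolding strong_semilattice_of_groups_def
proof (intro conjI exI[where x = "\<lambda>S T. proj T"] ballI impI)
  show "semilattice_of_groups (residue_ring n) (Pow I) (unit_component I p)"
    by (rule semilattice_unit_component)
next
  fix S T assume "S \<in> Pow I" "T \<subseteq> S"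
  then show "proj T \<in> hom (restrict_mult (residue_ring n) (unit_component I p S))
                       (restrict_mult (residue_ring n) (unit_component I p T))"
    by (intro proj_hom) auto
next
  fix S x assume "S \<in> Pow I" "x \<in> unit_component I p S"
  then show "proj S x = x"
    by (intro proj_unit_component) auto
next
  fix S T R x assume "T \<in> Pow I" "R \<subseteq> T"
  then show "proj R (proj T x) = proj R x"
    by (intro proj_proj) auto
next
  fix S T x y
  assume "S \<in> Pow I" "T \<in> Pow I" "x \<in> unit_component I p S" "y \<in> unit_component I p T"
  then show "x \<otimes>\<^bsub>residue_ring n\<^esub> y = proj (inf S T) x \<otimes>\<^bsub>residue_ring n\<^esub> proj (inf S T) y"
    using mult_eq_mult_proj by simp
qed

end

theorem proposition1p1:
  fixes m :: nat and p :: "nat \<Rightarrow> int" and I :: "nat set" and n :: int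
  assumes "m > 0"
    and "I = {1..m}"
    and "\<forall>i\<in>I. prime (p i)"
    and "inj_on p I"
    and "n = (\<Prod>i\<in>I. p i)"
  shows "(\<forall>S. S \<subseteq> I \<and> S \<noteq> {} \<longrightarrow>
            semigroup_subgroup (unit_component I p S) (residue_ring n) \<and>
            restrict_mult (residue_ring n) (unit_component I p S)
              \<cong> units_of (residue_ring (\<Prod>i\<in>S. p i))) \<and>
         carrier (residue_ring n) = (\<Union>S\<in>Pow I. unit_component I p S) \<and>
         disjoint_family_on (unit_component I p) (Pow I) \<and>
         strong_semilattice_of_groups (residue_ring n) (Pow I) (unit_component I p)"
proof -
  interpret distinct_primes I p
    by unfold_locales (use assms in auto)
  show ?thesis
    unfolding \<open>n = (\<Prod>i\<in>I. p i)\<close>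
    using unit_component_subgroup unit_component_iso_units residues_eq_Union_unit_component
      disjoint_unit_component strong_semilattice_unit_component
    by simp
qed

end
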